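(* Let $F$ be a finite group. (1) There exists a generating set $S$ for $F$ with $S^N\neq F$ for all $N\in\mathbb{Z}$ if and only if $F$ is not perfect. (2) There exists a generating set $S$ for $F$ with $S^{-1}=S$ and $S^N\neq F$ for all $N\in\mathbb{Z}$ if and only if there is a surjective homomorphism from $F$ to the cyclic group $C_2$ of order 2.
   Context: For a subset $S$ of a group with identity $e$: $S^{-1}=\{s^{-1}:s\in S\}$, $S^0=\{e\}$, $S^N=\{s_1\cdots s_N:s_i\in S\}$ for $N>0$, and $S^{-N}=(S^{-1})^N$ for $N>0$. A group $F$ is perfect if its commutator subgroup $F'$ equals $F$. *)

theory Defs
  imports "HOL-Algebra.Algebra"
begin

text \<open>The set of all products \<open>s\<^sub>1 \<cdots> s\<^sub>n\<close> with every \<open>s\<^sub>i\<close> in \<open>S\<close>; for \<open>n = 0\<close> the only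
  product is the empty one, so the set is \<open>{\<one>}\<close>.\<close>

definition set_nat_pow :: "('a, 'b) monoid_scheme \<Rightarrow> 'a set \<Rightarrow> nat \<Rightarrow> 'a set" where
  "set_nat_pow G S n =
     {foldr (\<lambda>s t. s \<otimes>\<^bsub>G\<^esub> t) ss \<one>\<^bsub>G\<^esub> | ss. set ss \<subseteq> S \<and> length ss = n}"

definition set_int_pow :: "('a, 'b) monoid_scheme \<Rightarrow> 'a set \<Rightarrow> int \<Rightarrow> 'a set" where
  "set_int_pow G S N =
     (if 0 \<le> N then set_nat_pow G S (nat N) else set_nat_pow G (set_inv\<^bsub>G\<^esub> S) (nat (- N)))"

definition generating_set :: "('a, 'b) monoid_scheme \<Rightarrow> 'a set \<Rightarrow> bool" where
  "generating_set G S \<longleftrightarrow> S \<subseteq> carrier G \<and> generate G S = carrier G"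

definition perfect_group :: "('a, 'b) monoid_scheme \<Rightarrow> bool" where
  "perfect_group G \<longleftrightarrow> group G \<and> derived G (carrier G) = carrier G"

end

theory Submission
  imports Defs
begin

text \<open>A homomorphism that is constant on \<open>S\<close> is constant on every power of \<open>S\<close>, so it separates
  the powers of \<open>S\<close> from the group unless it is trivial. Such an \<open>S\<close> is a nontrivial coset of a
  normal subgroup, and it generates as soon as that subgroup is maximal: for (1) take a maximal
  proper subgroup above the commutator subgroup, for (2) the kernel of the map to \<open>C\<^sub>2\<close>.

  Conversely, in a finite group the union of the \<open>S\<^bsup>km\<^esup>\<close> over \<open>k\<close> is a subgroup, and it equals a
  single \<open>S\<^bsup>km\<^esup>\<close> if \<open>\<one> \<in> S\<^sup>m\<close>. For \<open>m = |F|\<close> it contains all commutators, because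
  \<open>x\<^sup>-\<^sup>1 = x\<^bsup>m-1\<^esup>\<close>. If \<open>S\<close> is symmetric then \<open>m = 2\<close> works, and the subgroup, when proper, has
  index 2.\<close>

section \<open>Powers of a set\<close>

context group
begin

lemma set_nat_pow_0: "set_nat_pow G S 0 = {\<one>}"
  by (auto simp: set_nat_pow_def)

lemma set_nat_pow_1:
  assumes "S \<subseteq> carrier G" "s \<in> S"
  shows "s \<in> set_nat_pow G S 1"
proof -
  have "s = foldr (\<otimes>) [s] \<one>" "set [s] \<subseteq> S" "length [s] = 1"
    using assms by auto
  then show ?thesis unfolding set_nat_pow_def by blast
qed

lemma foldr_mult_closed:
  assumes "set ss \<subseteq> carrier G"
  shows "foldr (\<otimes>) ss \<one> \<in> carrier G"
  using assms by (induction ss) auto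

lemma foldr_mult_append:
  assumes "set ss \<subseteq> carrier G" "set ts \<subseteq> carrier G"
  shows "foldr (\<otimes>) (ss @ ts) \<one> = foldr (\<otimes>) ss \<one> \<otimes> foldr (\<otimes>) ts \<one>"
  using assms(1)
proof (induction ss)
  case (Cons s ss)
  then show ?case
    using foldr_mult_closed[of ss] foldr_mult_closed[OF assms(2)] by (simp add: m_assoc)
qed (use foldr_mult_closed[OF assms(2)] in simp)

lemma set_nat_pow_closed:
  assumes "S \<subseteq> carrier G" "x \<in> set_nat_pow G S n"
  shows "x \<in> carrier G"
  using assms foldr_mult_closed by (auto simp: set_nat_pow_def)

lemma set_nat_pow_mult:
  assumes "S \<subseteq> carrier G" "x \<in> set_nat_pow G S i" "y \<in> set_nat_pow G S j"
  shows "x \<otimes> y \<in> set_nat_pow G S (i + j)"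
proof -
  obtain ss ts where "x = foldr (\<otimes>) ss \<one>" "set ss \<subseteq> S" "length ss = i"
    and "y = foldr (\<otimes>) ts \<one>" "set ts \<subseteq> S" "length ts = j"
    using assms by (auto simp: set_nat_pow_def)
  then have "x \<otimes> y = foldr (\<otimes>) (ss @ ts) \<one>" "set (ss @ ts) \<subseteq> S" "length (ss @ ts) = i + j"
    using assms(1) foldr_mult_append[of ss ts] by auto
  then show ?thesis unfolding set_nat_pow_def by blast
qed

lemma set_nat_pow_pow:
  assumes "S \<subseteq> carrier G" "x \<in> set_nat_pow G S i"
  shows "x [^] n \<in> set_nat_pow G S (n * i)"
proof (induction n)
  case (Suc n)
  then show ?case
    using set_nat_pow_mult[OF assms(1) Suc assms(2)] by (simp add: add.commute)
qed (simp add: set_nat_pow_0)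

text \<open>In a finite group \<open>inv x\<close> is the power of \<open>x\<close> with exponent
  \<open>order G - 1\<close>, so inverses are reached by products from \<open>S\<close> alone, with
  a length that is still a multiple of \<open>i\<close>.\<close>

lemma set_nat_pow_inv:
  assumes "finite (carrier G)" "S \<subseteq> carrier G" "x \<in> set_nat_pow G S i"
  shows "inv x \<in> set_nat_pow G S ((order G - 1) * i)"
proof -
  have x: "x \<in> carrier G" using assms set_nat_pow_closed by blast
  have "order G > 0" using assms(1) order_gt_0_iff_finite by blast
  then have "x [^] (order G - 1) \<otimes> x = \<one>"
    using pow_order_eq_1[OF x] by (metis Suc_diff_1 nat_pow_Suc)
  then have "inv x = x [^] (order G - 1)"
    using x inv_equality by blast
  then show ?thesis using set_nat_pow_pow[OF assms(2,3)] by simp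
qed

text \<open>Lengths add under products and are multiplied by \<open>order G - 1\<close> under
  inverses; both operations preserve divisibility by \<open>m\<close>.\<close>

lemma subgroup_Union_set_nat_pow:
  assumes "finite (carrier G)" "S \<subseteq> carrier G"
  shows "subgroup (\<Union>k. set_nat_pow G S (k * m)) G"
proof (rule subgroupI)
  show "(\<Union>k. set_nat_pow G S (k * m)) \<subseteq> carrier G"
    using set_nat_pow_closed[OF assms(2)] by blast
  have "\<one> \<in> set_nat_pow G S (0 * m)"
    using set_nat_pow_0 by simp
  then show "(\<Union>k. set_nat_pow G S (k * m)) \<noteq> {}" by blast
next
  fix x assume "x \<in> (\<Union>k. set_nat_pow G S (k * m))"
  then obtain k where "x \<in> set_nat_pow G S (k * m)" by blast
  then have "inv x \<in> set_nat_pow G S ((order G - 1) * k * m)"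
    using set_nat_pow_inv[OF assms] by (simp add: mult.assoc)
  then show "inv x \<in> (\<Union>k. set_nat_pow G S (k * m))" by blast
next
  fix x y assume "x \<in> (\<Union>k. set_nat_pow G S (k * m))" "y \<in> (\<Union>k. set_nat_pow G S (k * m))"
  then obtain k l where "x \<in> set_nat_pow G S (k * m)" "y \<in> set_nat_pow G S (l * m)" by blast
  then have "x \<otimes> y \<in> set_nat_pow G S ((k + l) * m)"
    using set_nat_pow_mult[OF assms(2)] by (simp add: distrib_right)
  then show "x \<otimes> y \<in> (\<Union>k. set_nat_pow G S (k * m))" by blast
qed

text \<open>The case \<open>m = 1\<close> of the union: it is a subgroup containing
  \<open>S\<close>, hence everything.\<close>

lemma generating_set_imp_mem_set_nat_pow:
  assumes "finite (carrier G)" "generating_set G S" "x \<in> carrier G"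
  obtains k where "x \<in> set_nat_pow G S k"
proof -
  have S: "S \<subseteq> carrier G" "generate G S = carrier G"
    using assms(2) by (auto simp: generating_set_def)
  have sub: "subgroup (\<Union>k. set_nat_pow G S k) G"
    using subgroup_Union_set_nat_pow[OF assms(1) S(1), of 1] by simp
  have "S \<subseteq> (\<Union>k. set_nat_pow G S k)"
    using set_nat_pow_1[OF S(1)] by blast
  then have "carrier G \<subseteq> (\<Union>k. set_nat_pow G S k)"
    using generate_subgroup_incl[OF _ sub, of S] S(2) by simp
  then show thesis using that assms(3) by blast
qed

text \<open>Since 1 lies in S^m, products can be padded with it, so the sets S^(km) increase with
  \<open>k\<close>. A finite group that is their union is then exhausted by one of them.\<close>

lemma set_nat_pow_eq_carrier:
  assumes "finite (carrier G)" "S \<subseteq> carrier G" "\<one> \<in> set_nat_pow G S m"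
    and "(\<Union>k. set_nat_pow G S (k * m)) = carrier G"
  obtains n where "set_nat_pow G S n = carrier G"
proof -
  have mono: "x \<in> set_nat_pow G S (l * m)" if "x \<in> set_nat_pow G S (k * m)" "k \<le> l" for x k l
  proof -
    have "\<one> \<in> set_nat_pow G S ((l - k) * m)"
      using set_nat_pow_pow[OF assms(2,3), of "l - k"] by simp
    then have "x \<otimes> \<one> \<in> set_nat_pow G S (k * m + (l - k) * m)"
      using set_nat_pow_mult[OF assms(2)] that(1) by blast
    moreover have "k * m + (l - k) * m = l * m"
      using that(2) by (simp add: distrib_right [symmetric])
    ultimately show ?thesis
      using set_nat_pow_closed[OF assms(2) that(1)] by simp
  qed
  have "\<forall>x \<in> carrier G. \<exists>k. x \<in> set_nat_pow G S (k * m)"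
    using assms(4) by blast
  then obtain k where k: "\<And>x. x \<in> carrier G \<Longrightarrow> x \<in> set_nat_pow G S (k x * m)"
    by metis
  \<comment> \<open>A multiplier that serves all elements at once; the maximum exists by
    finiteness.\<close>
  define n where "n = Max (k ` carrier G)"
  have "k x \<le> n" if "x \<in> carrier G" for x
    using that assms(1) by (simp add: n_def)
  then have "set_nat_pow G S (n * m) = carrier G"
    using k mono set_nat_pow_closed[OF assms(2)] by blast
  then show thesis using that by blast
qed

end

section \<open>Fibres of a homomorphism\<close>

context group_hom
begin

lemma hom_set_nat_pow:
  assumes "S \<subseteq> carrier G" "\<And>s. s \<in> S \<Longrightarrow> h s = c" "x \<in> set_nat_pow G S n"
  shows "h x = c [^]\<^bsub>H\<^esub> n"
proof -
  obtain ss where "x = foldr (\<otimes>) ss \<one>" "set ss \<subseteq> S" "length ss = n"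
    using assms(3) by (auto simp: set_nat_pow_def)
  moreover have "h (foldr (\<otimes>) ss \<one>) = c [^]\<^bsub>H\<^esub> length ss" if "set ss \<subseteq> S" for ss
    using that
  proof (induction ss)
    case (Cons s ss)
    have "s \<in> carrier G" "c \<in> carrier H"
      using Cons.prems assms(1,2) hom_closed[of s] by auto
    moreover have "foldr (\<otimes>) ss \<one> \<in> carrier G"
      using Cons.prems assms(1) by (intro G.foldr_mult_closed) auto
    ultimately show ?case
      using Cons assms(2)[of s] H.nat_pow_Suc2[of c "length ss"] by simp
  qed simp
  ultimately show ?thesis by blast
qed

text \<open>On a power of \<open>S\<close> the map \<open>h\<close> takes one value only, whereas on
  the whole group it takes at least two, at \<open>a\<close> and at the identity. Negative exponents
  reduce to the same argument, because \<open>h\<close> is constant on the inverse set too, with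
  value the inverse of \<open>c\<close>.\<close>

lemma set_int_pow_ne_carrier:
  assumes "S \<subseteq> carrier G" "\<And>s. s \<in> S \<Longrightarrow> h s = c" "a \<in> carrier G" "h a \<noteq> \<one>\<^bsub>H\<^esub>"
  shows "set_int_pow G S N \<noteq> carrier G"
proof -
  have *: "set_nat_pow G T n \<noteq> carrier G"
    if "T \<subseteq> carrier G" "\<And>t. t \<in> T \<Longrightarrow> h t = d" for T d n
  proof
    assume "set_nat_pow G T n = carrier G"
    then have "h x = d [^]\<^bsub>H\<^esub> n" if "x \<in> carrier G" for x
      using hom_set_nat_pow[OF \<open>T \<subseteq> carrier G\<close> \<open>\<And>t. t \<in> T \<Longrightarrow> h t = d\<close>] that by blast
    from this[OF assms(3)] this[OF G.one_closed] show False
      using assms(4) by simp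
  qed
  have "set_inv S \<subseteq> carrier G" "\<And>t. t \<in> set_inv S \<Longrightarrow> h t = inv\<^bsub>H\<^esub> c"
    using assms(1,2) by (auto simp: SET_INV_def subset_iff)
  with * assms(1,2) show ?thesis
    by (simp add: set_int_pow_def)
qed

text \<open>For \<open>x\<close> in the kernel both \<open>g\<close> and \<open>g x\<close> lie in
  the fibre of \<open>g\<close>, and \<open>x\<close> is their quotient.\<close>

lemma kernel_subset_generate_fibre:
  assumes "g \<in> carrier G"
  shows "kernel G H h \<subseteq> generate G {x \<in> carrier G. h x = h g}"
proof
  fix x assume "x \<in> kernel G H h"
  then have x: "x \<in> carrier G" "h x = \<one>\<^bsub>H\<^esub>" by (auto simp: kernel_def)
  let ?S = "{x \<in> carrier G. h x = h g}"
  have "inv g \<in> generate G ?S" "g \<otimes> x \<in> generate G ?S"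
    using assms x by (auto intro: generate.inv generate.incl)
  then have "inv g \<otimes> (g \<otimes> x) \<in> generate G ?S" by (rule generate.eng)
  then show "x \<in> generate G ?S"
    using assms x by (simp add: G.m_assoc[symmetric])
qed

text \<open>The fibre generates a subgroup containing the kernel and also \<open>g\<close>, which is
  outside it; maximality of the kernel leaves only the whole group.\<close>

lemma generating_set_fibre:
  assumes "g \<in> carrier G"
    and max: "\<And>K. subgroup K G \<Longrightarrow> kernel G H h \<subset> K \<Longrightarrow> K = carrier G"
    and "h g \<noteq> \<one>\<^bsub>H\<^esub>"
  shows "generating_set G {x \<in> carrier G. h x = h g}"
proof -
  let ?S = "{x \<in> carrier G. h x = h g}"
  have "g \<in> generate G ?S" using assms(1) by (auto intro: generate.incl)
  moreover have "g \<notin> kernel G H h" using assms(3) by (simp add: kernel_def)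
  ultimately have "kernel G H h \<subset> generate G ?S"
    using kernel_subset_generate_fibre[OF assms(1)] by blast
  moreover have "subgroup (generate G ?S) G"
    by (rule G.generate_is_subgroup) auto
  ultimately have "generate G ?S = carrier G"
    by (rule max[rotated])
  then show ?thesis
    by (simp add: generating_set_def subset_iff)
qed

end

section \<open>Perfect groups\<close>

context group
begin

text \<open>A conjugate differs from the element by a commutator: x n x^-1 = [x,n] n.\<close>

lemma derived_subset_imp_normal:
  assumes "subgroup N G" "derived G (carrier G) \<subseteq> N"
  shows "N \<lhd> G"
proof (rule normal_invI[OF assms(1)])
  fix x n assume x: "x \<in> carrier G" and n: "n \<in> N"
  then have nc: "n \<in> carrier G" using subgroup.mem_carrier[OF assms(1)] by blast
  have "x \<otimes> n \<otimes> inv x \<otimes> inv n \<in> derived_set G (carrier G)"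
    using x nc by blast
  then have "x \<otimes> n \<otimes> inv x \<otimes> inv n \<in> derived G (carrier G)"
    unfolding derived_def by (rule generate.incl)
  then have "x \<otimes> n \<otimes> inv x \<otimes> inv n \<otimes> n \<in> N"
    using subgroup.m_closed[OF assms(1)] assms(2) n by (simp add: subset_iff)
  then show "x \<otimes> n \<otimes> inv x \<in> N"
    using x nc by (simp add: m_assoc)
qed

lemma not_perfect_imp_powers_proper:
  assumes "finite (carrier G)" "\<not> perfect_group G"
  shows "\<exists>S. generating_set G S \<and> (\<forall>N. set_int_pow G S N \<noteq> carrier G)"
proof -
  \<comment> \<open>The proper subgroups above the commutator subgroup. Non-perfectness puts the
    commutator subgroup itself among them, and finiteness gives a maximal member \<open>N\<close>,
    which is normal and will be the kernel.\<close>
  let ?A = "{K. subgroup K G \<and> derived G (carrier G) \<subseteq> K \<and> K \<noteq> carrier G}"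
  have "?A \<subseteq> Pow (carrier G)" using subgroup.subset by blast
  then have fin: "finite ?A" using assms(1) finite_subset by blast
  have der: "derived G (carrier G) \<in> ?A"
    using assms(2) derived_is_subgroup[of "carrier G"] is_group by (simp add: perfect_group_def)
  obtain N where "N \<in> ?A" and "\<forall>K\<in>?A. N \<subseteq> K \<longrightarrow> N = K"
    using finite_has_maximal2[OF fin der] by (elim bexE conjE)
  then have N: "subgroup N G" "derived G (carrier G) \<subseteq> N" "N \<noteq> carrier G"
    and max: "\<And>K. subgroup K G \<Longrightarrow> derived G (carrier G) \<subseteq> K \<Longrightarrow> K \<noteq> carrier G \<Longrightarrow> N \<subseteq> K \<Longrightarrow> N = K"
    by simp_all
  interpret N: normal N G using derived_subset_imp_normal[OF N(1,2)] .
  interpret h: group_hom G "G Mod N" "\<lambda>x. N #> x"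
    by (simp add: group_hom_def group_hom_axioms_def is_group N.factorgroup_is_group
        N.r_coset_hom_Mod)
  have one: "\<one>\<^bsub>G Mod N\<^esub> = N" by simp
  have ker: "kernel G (G Mod N) (\<lambda>x. N #> x) = N"
    using coset_join1[OF _ _ N.subgroup_axioms] coset_join2[OF _ N.subgroup_axioms] N.subset
    by (auto simp: kernel_def)
  obtain g where g: "g \<in> carrier G" "g \<notin> N" using N N.subset by blast
  then have hg: "N #> g \<noteq> \<one>\<^bsub>G Mod N\<^esub>"
    using coset_join1[OF _ g(1) N.subgroup_axioms] by auto
  let ?S = "{x \<in> carrier G. N #> x = N #> g}"
  have "K = carrier G" if "subgroup K G" "N \<subset> K" for K
    using max[OF that(1)] that(2) N(2) by auto
  then have "generating_set G ?S"
    using h.generating_set_fibre[OF g(1) _ hg] ker by simp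
  moreover have "set_int_pow G ?S n \<noteq> carrier G" for n
    by (rule h.set_int_pow_ne_carrier[OF _ _ g(1) hg]) auto
  ultimately show ?thesis by blast
qed

text \<open>If \<open>a\<close> and \<open>b\<close> have lengths \<open>i\<close> and
  \<open>j\<close>, their inverses have lengths \<open>i\<close> and \<open>j\<close> times
  \<open>order G - 1\<close>, so the commutator has length \<open>(i + j) * order G\<close>.\<close>

lemma derived_subset_Union_set_nat_pow_order:
  assumes "finite (carrier G)" "generating_set G S"
  shows "derived G (carrier G) \<subseteq> (\<Union>k. set_nat_pow G S (k * order G))"
proof -
  have S: "S \<subseteq> carrier G" using assms(2) by (simp add: generating_set_def)
  have "a \<otimes> b \<otimes> inv a \<otimes> inv b \<in> (\<Union>k. set_nat_pow G S (k * order G))"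
    if a: "a \<in> carrier G" and b: "b \<in> carrier G" for a b
  proof -
    obtain i j where "a \<in> set_nat_pow G S i" "b \<in> set_nat_pow G S j"
      using generating_set_imp_mem_set_nat_pow[OF assms a]
        generating_set_imp_mem_set_nat_pow[OF assms b] by metis
    then have "a \<otimes> b \<otimes> inv a \<otimes> inv b
        \<in> set_nat_pow G S (i + j + (order G - 1) * i + (order G - 1) * j)"
      by (intro set_nat_pow_mult set_nat_pow_inv assms(1) S)
    moreover have "i + j + (order G - 1) * i + (order G - 1) * j = (i + j) * order G"
    proof -
      have "order G > 0" using assms(1) order_gt_0_iff_finite by blast
      then obtain m where "order G = Suc m" using gr0_implies_Suc by blast
      then show ?thesis by (simp add: algebra_simps)
    qed
    ultimately show ?thesis by auto
  qed
  then have "derived_set G (carrier G) \<subseteq> (\<Union>k. set_nat_pow G S (k * order G))" by blast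
  then show ?thesis
    unfolding derived_def
    by (rule generate_subgroup_incl[OF _ subgroup_Union_set_nat_pow[OF assms(1) S]])
qed

lemma perfect_imp_power_eq_carrier:
  assumes "finite (carrier G)" "perfect_group G" "generating_set G S"
  shows "\<exists>n. set_nat_pow G S n = carrier G"
\<comment> \<open>The empty set generates the trivial group, which equals S^0. Otherwise some
  \<open>s\<close> in \<open>S\<close> exists, and its power with exponent \<open>order G\<close>
  shows that 1 is in S^m for m = \<open>order G\<close>.\<close>
proof (cases "S = {}")
  case True
  then have "carrier G = {\<one>}"
    using assms(3) generate_empty by (simp add: generating_set_def)
  then show ?thesis using set_nat_pow_0 by blast
next
  case False
  then obtain s where s: "s \<in> S" by blast
  have S: "S \<subseteq> carrier G" using assms(3) by (simp add: generating_set_def)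
  have "s [^] order G \<in> set_nat_pow G S (order G)"
    using set_nat_pow_pow[OF S set_nat_pow_1[OF S s], of "order G"] by simp
  then have "\<one> \<in> set_nat_pow G S (order G)"
    using s S pow_order_eq_1 by auto
  moreover have "(\<Union>k. set_nat_pow G S (k * order G)) = carrier G"
    using derived_subset_Union_set_nat_pow_order[OF assms(1,3)] assms(2)
      set_nat_pow_closed[OF S] by (auto simp: perfect_group_def)
  ultimately show ?thesis
    using set_nat_pow_eq_carrier[OF assms(1) S] by metis
qed

section \<open>Symmetric generating sets\<close>

lemma surj_hom_C2_imp_symmetric_powers_proper:
  assumes f: "f \<in> hom G (integer_mod_group 2)"
    and surj: "f ` carrier G = carrier (integer_mod_group 2)"
  shows "\<exists>S. generating_set G S \<and> set_inv S = S \<and> (\<forall>N. set_int_pow G S N \<noteq> carrier G)"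
proof -
  interpret f: group_hom G "integer_mod_group 2" f
    by (simp add: group_hom_def group_hom_axioms_def is_group f)
  have C2: "carrier (integer_mod_group 2) = {0, 1}"
    by (auto simp: carrier_integer_mod_group)
  have f01: "f x = 0 \<or> f x = 1" if "x \<in> carrier G" for x
    using f.hom_closed[OF that] C2 by auto
  obtain g where g: "g \<in> carrier G" "f g = 1"
    using surj C2 by (metis imageE insertCI)
  let ?S = "{x \<in> carrier G. f x = f g}"
  \<comment> \<open>The kernel is maximal because it has index 2: for \<open>k\<close> in
    \<open>K\<close> outside the kernel, every \<open>x\<close> outside the kernel satisfies
    \<open>f (x k) = 1 + 1 = 0\<close>, so \<open>x k\<close>, and with it \<open>x\<close>, lies in
    \<open>K\<close>.\<close>
  have "K = carrier G"
    if K: "subgroup K G" and ker: "kernel G (integer_mod_group 2) f \<subset> K" for K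
  proof -
    obtain k where k: "k \<in> K" "k \<notin> kernel G (integer_mod_group 2) f" using ker by blast
    have kc: "k \<in> carrier G" using subgroup.mem_carrier[OF K k(1)] .
    then have fk: "f k = 1" using k f01 by (auto simp: kernel_def)
    have "x \<in> K" if x: "x \<in> carrier G" for x
    proof (cases "f x = 0")
      case True
      then show ?thesis using x ker by (auto simp: kernel_def)
    next
      case False
      then have "f x = 1" using f01 x by blast
      then have "f (x \<otimes> k) = 0" using x kc fk by simp
      then have "x \<otimes> k \<in> K" using x kc ker by (auto simp: kernel_def)
      then have "x \<otimes> k \<otimes> inv k \<in> K"
        using K k subgroup.m_closed subgroup.m_inv_closed by metis
      then show ?thesis using x kc by (simp add: m_assoc)
    qed
    then show ?thesis using K subgroup.subset by blast
  qed
  then have "generating_set G ?S"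
    using f.generating_set_fibre[OF g(1)] g(2) by simp
  moreover have "set_inv ?S = ?S"
  \<comment> \<open>The fibre over 1 is symmetric since 1 is its own inverse in the group of order
    2.\<close>
  proof -
    have inv: "inv x \<in> ?S" if "x \<in> ?S" for x
    proof -
      have "f (inv x) = inv\<^bsub>integer_mod_group 2\<^esub> 1" using that g by simp
      also have "\<dots> = 1" by (subst inv_integer_mod_group) auto
      finally show ?thesis using that g by simp
    qed
    have "x \<in> set_inv ?S" if "x \<in> ?S" for x
    proof -
      have "x = inv (inv x)" using that by simp
      then show ?thesis using inv[OF that] unfolding SET_INV_def by blast
    qed
    moreover have "set_inv ?S \<subseteq> ?S" using inv unfolding SET_INV_def by blast
    ultimately show ?thesis by blast
  qed
  moreover have "set_int_pow G ?S n \<noteq> carrier G" for n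
    by (rule f.set_int_pow_ne_carrier[OF _ _ g(1)]) (use g in auto)
  ultimately show ?thesis by blast
qed

lemma symmetric_powers_proper_imp_surj_hom_C2:
  assumes fin: "finite (carrier G)" and gen: "generating_set G S" and sym: "set_inv S = S"
    and proper: "\<And>n. set_nat_pow G S n \<noteq> carrier G"
  shows "\<exists>f. f \<in> hom G (integer_mod_group 2) \<and> f ` carrier G = carrier (integer_mod_group 2)"
proof -
  have S: "S \<subseteq> carrier G" using gen by (simp add: generating_set_def)
  have "S \<noteq> {}"
  proof
    assume "S = {}"
    then have "carrier G = {\<one>}"
      using gen generate_empty by (simp add: generating_set_def)
    then show False using proper set_nat_pow_0 by metis
  qed
  then obtain s where s: "s \<in> S" by blast
  then have "inv s \<in> S" using sym unfolding SET_INV_def by blast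
  then have "s \<otimes> inv s \<in> set_nat_pow G S (1 + 1)"
    using s by (intro set_nat_pow_mult set_nat_pow_1 S)
  then have one2: "\<one> \<in> set_nat_pow G S 2"
    using s S by (simp add: subset_iff numeral_2_eq_2)
  \<comment> \<open>The elements expressible by products of even length. As 1 = s s^-1 lies in S^2,
    the subgroup \<open>E\<close> would be a single power of \<open>S\<close> if it were everything,
    contrary to \<open>proper\<close>.\<close>
  define E where "E = (\<Union>k. set_nat_pow G S (k * 2))"
  have E: "subgroup E G"
    unfolding E_def using subgroup_Union_set_nat_pow[OF fin S] .
  have E_ne: "E \<noteq> carrier G"
    using set_nat_pow_eq_carrier[OF fin S one2] proper unfolding E_def by metis
  have odd: "\<exists>i. odd i \<and> x \<in> set_nat_pow G S i" if x: "x \<in> carrier G" "x \<notin> E" for x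
  proof -
    obtain i where i: "x \<in> set_nat_pow G S i"
      using generating_set_imp_mem_set_nat_pow[OF fin gen x(1)] .
    moreover have "odd i"
    proof
      assume "even i"
      then obtain k where "i = k * 2" by (metis dvd_div_mult_self)
      then show False using i x(2) by (auto simp: E_def)
    qed
    ultimately show ?thesis by blast
  qed
  \<comment> \<open>This says that \<open>E\<close> has index at most 2. The essential case is two
    factors outside \<open>E\<close>: both have odd length, so their product has even length. The
    other cases only use that \<open>E\<close> is a subgroup.\<close>
  have mul: "x \<otimes> y \<in> E \<longleftrightarrow> (x \<in> E \<longleftrightarrow> y \<in> E)" if x: "x \<in> carrier G" and y: "y \<in> carrier G" for x y
  proof (cases "x \<in> E \<or> y \<in> E")
    case True
    have "x \<otimes> y \<in> E" if "x \<in> E" "y \<in> E"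
      using that E subgroup.m_closed by metis
    moreover have "y \<in> E" if "x \<in> E" "x \<otimes> y \<in> E"
    proof -
      have "inv x \<otimes> (x \<otimes> y) \<in> E"
        using that E subgroup.m_closed subgroup.m_inv_closed by metis
      then show ?thesis using x y by (simp add: m_assoc[symmetric])
    qed
    moreover have "x \<in> E" if "y \<in> E" "x \<otimes> y \<in> E"
    proof -
      have "x \<otimes> y \<otimes> inv y \<in> E"
        using that E subgroup.m_closed subgroup.m_inv_closed by metis
      then show ?thesis using x y by (simp add: m_assoc)
    qed
    ultimately show ?thesis using True by blast
  next
    case False
    then obtain i j where ij: "odd i" "x \<in> set_nat_pow G S i" "odd j" "y \<in> set_nat_pow G S j"
      using odd x y by metis
    then have "even (i + j)" by simp
    then obtain k where "i + j = k * 2" by (metis dvd_div_mult_self)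
    then have "x \<otimes> y \<in> set_nat_pow G S (k * 2)"
      using set_nat_pow_mult[OF S ij(2,4)] by simp
    then show ?thesis using False by (auto simp: E_def)
  qed
  \<comment> \<open>The quotient map by \<open>E\<close>, written as an indicator;
    \<open>mul\<close> is exactly its additivity modulo 2, and \<open>E_ne\<close> makes the value 1
    occur.\<close>
  define f :: "'a \<Rightarrow> int" where "f x = (if x \<in> E then 0 else 1)" for x
  have C2: "carrier (integer_mod_group 2) = {0, 1}"
    by (auto simp: carrier_integer_mod_group)
  have "f \<in> hom G (integer_mod_group 2)"
    by (rule homI) (auto simp: f_def C2 mul)
  moreover have "f ` carrier G = {0, 1}"
  proof -
    obtain g where "g \<in> carrier G" "g \<notin> E" using E_ne subgroup.subset[OF E] by blast
    then have "1 \<in> f ` carrier G" by (force simp: f_def)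
    moreover have "0 \<in> f ` carrier G"
      using subgroup.one_closed[OF E] one_closed by (force simp: f_def)
    ultimately show ?thesis by (auto simp: f_def)
  qed
  ultimately show ?thesis using C2 by auto
qed

end

theorem theorem3p10:
  fixes F :: "('a, 'b) monoid_scheme"
  assumes "group F" and "finite (carrier F)"
  shows "((\<exists>S. generating_set F S \<and> (\<forall>N::int. set_int_pow F S N \<noteq> carrier F))
            \<longleftrightarrow> \<not> perfect_group F)
       \<and> ((\<exists>S. generating_set F S \<and> set_inv\<^bsub>F\<^esub> S = S \<and> (\<forall>N::int. set_int_pow F S N \<noteq> carrier F))
            \<longleftrightarrow> (\<exists>f. f \<in> hom F (integer_mod_group 2) \<and> f ` carrier F = carrier (integer_mod_group 2)))"
proof -
  interpret group F by fact
  \<comment> \<open>The converse directions need the hypothesis at nonnegative exponents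
    only.\<close>
  have nat: "set_nat_pow F S n \<noteq> carrier F" if "\<forall>N::int. set_int_pow F S N \<noteq> carrier F" for S n
    using that[rule_format, of "int n"] by (simp add: set_int_pow_def)
  show ?thesis
    using nat not_perfect_imp_powers_proper[OF assms(2)] perfect_imp_power_eq_carrier[OF assms(2)]
      surj_hom_C2_imp_symmetric_powers_proper symmetric_powers_proper_imp_surj_hom_C2[OF assms(2)]
    by meson
qed

end
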